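(* Let $n\ge 2$ be an integer and let $D_n$ be the dihedral group of order $2n$. The following statements are equivalent: (1) $Co_{\mathcal{H}}(D_n)$ is a hypertree. (2) $n=p^{\alpha}$, where $p$ is a prime and $\alpha\ge 1$ is an integer. (3) $Co_{\mathcal{H}}(D_n)$ is a star hypergraph.
   Context: For $n\ge 1$, $D_n=\langle a,b \mid a^n=e,\ b^2=e,\ bab^{-1}=a^{-1}\rangle$ is the dihedral group of order $2n$ (so $D_2$ is the Klein four-group). For a group $G$, let $S$ be the set of all non-trivial proper subgroups of $G$ (i.e. subgroups different from $\{e\}$ and $G$). For subgroups $H,K$, $HK=\{hk : h\in H, k\in K\}$. The co-maximal hypergraph $Co_{\mathcal{H}}(G)$ has vertex set $V=\{H\in S : HK=G \text{ for some } K\in S\}$, and a subset $E\subseteq V$ is a hyperedge if and only if (1) $HK=G$ for all distinct $H,K\in E$, and (2) no subset $E'\subseteq V$ properly containing $E$ satisfies (1). A hypergraph $\mathcal{H}=(X,\mathcal{D})$ is a hypertree if there exists a tree $T=(X,E)$ on the same vertex set $X$ (a host tree) such that each hyperedge $D\in\mathcal{D}$ induces a subtree (i.e. a connected subgraph) of $T$. A hypergraph is a star hypergraph if there is a vertex which belongs to all hyperedges. *)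

theory Defs
  imports "HOL-Algebra.Coset" "HOL-Computational_Algebra.Primes"
begin

section \<open>Groups given by generators and relations\<close>

text \<open>
  A letter \<open>(x, True)\<close> stands for the generator \<open>x\<close>, and \<open>(x, False)\<close> for its formal inverse.
  A relation \<open>u = v\<close> is given as the pair of words \<open>(u, v)\<close>.
\<close>

type_synonym 'g word = "('g \<times> bool) list"

inductive word_cong :: "('g word \<times> 'g word) set \<Rightarrow> 'g word \<Rightarrow> 'g word \<Rightarrow> bool"
  for R where
  refl: "word_cong R u u"
| sym: "word_cong R u v \<Longrightarrow> word_cong R v u"
| trans: "word_cong R u v \<Longrightarrow> word_cong R v w \<Longrightarrow> word_cong R u w"
| mult: "word_cong R u u' \<Longrightarrow> word_cong R v v' \<Longrightarrow> word_cong R (u @ v) (u' @ v')"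
| cancel: "word_cong R [(x, s), (x, \<not> s)] []"
| relation: "(u, v) \<in> R \<Longrightarrow> word_cong R u v"

definition word_class :: "('g word \<times> 'g word) set \<Rightarrow> 'g word \<Rightarrow> 'g word set" where
  "word_class R u = {v. word_cong R u v}"

definition presented_group :: "('g word \<times> 'g word) set \<Rightarrow> 'g word set monoid" where
  "presented_group R =
    \<lparr>carrier = range (word_class R),
     monoid.mult = (\<lambda>X Y. \<Union>u\<in>X. \<Union>v\<in>Y. word_class R (u @ v)),
     one = word_class R []\<rparr>"

lemma word_class_eq_iff: "word_class R u = word_class R v \<longleftrightarrow> word_cong R u v"
  unfolding word_class_def set_eq_iff mem_Collect_eq
  by (metis word_cong.refl word_cong.sym word_cong.trans)

lemma mult_presented_group:
  "word_class R u \<otimes>\<^bsub>presented_group R\<^esub> word_class R v = word_class R (u @ v)"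
proof -
  have *: "word_class R (u' @ v') = word_class R (u @ v)"
    if "u' \<in> word_class R u" "v' \<in> word_class R v" for u' v'
    unfolding word_class_eq_iff
  proof (rule word_cong.mult)
    show "word_cong R u' u" "word_cong R v' v"
      using that by (simp_all add: word_class_def word_cong.sym)
  qed
  have "u \<in> word_class R u" "v \<in> word_class R v"
    by (simp_all add: word_class_def word_cong.refl)
  then have "(\<Union>u'\<in>word_class R u. \<Union>v'\<in>word_class R v. word_class R (u' @ v')) = word_class R (u @ v)"
    using * by blast
  then show ?thesis by (simp add: presented_group_def)
qed

lemma word_cong_inverse: "word_cong R (rev (map (\<lambda>(x, s). (x, \<not> s)) u) @ u) []"
proof (induction u)
  case Nil
  show ?case by (simp add: word_cong.refl)
next
  case (Cons a u)
  obtain x s where a: "a = (x, s)" by (cases a)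
  let ?v = "rev (map (\<lambda>(x, s). (x, \<not> s)) u)"
  have "word_cong R ([(x, \<not> s), (x, s)] @ u) ([] @ u)"
    using word_cong.cancel[of R x "\<not> s"] by (intro word_cong.mult word_cong.refl) simp
  then have "word_cong R (?v @ [(x, \<not> s), (x, s)] @ u) (?v @ u)"
    by (intro word_cong.mult word_cong.refl) simp
  then show ?case using Cons.IH by (auto simp: a intro: word_cong.trans)
qed

lemma group_presented_group: "group (presented_group R)"
proof (rule groupI)
  fix X assume "X \<in> carrier (presented_group R)"
  then obtain u where u: "X = word_class R u" by (auto simp: presented_group_def)
  have "word_class R (rev (map (\<lambda>(x, s). (x, \<not> s)) u)) \<otimes>\<^bsub>presented_group R\<^esub> X
      = \<one>\<^bsub>presented_group R\<^esub>"
    by (simp add: u mult_presented_group word_class_eq_iff word_cong_inverse)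
       (simp add: presented_group_def word_class_eq_iff word_cong_inverse)
  moreover have "word_class R (rev (map (\<lambda>(x, s). (x, \<not> s)) u)) \<in> carrier (presented_group R)"
    by (simp add: presented_group_def)
  ultimately show "\<exists>Y\<in>carrier (presented_group R). Y \<otimes>\<^bsub>presented_group R\<^esub> X = \<one>\<^bsub>presented_group R\<^esub>"
    by blast
next
  fix X Y assume "X \<in> carrier (presented_group R)" "Y \<in> carrier (presented_group R)"
  then obtain u v where "X = word_class R u" "Y = word_class R v" by (auto simp: presented_group_def)
  then have "X \<otimes>\<^bsub>presented_group R\<^esub> Y = word_class R (u @ v)" by (simp add: mult_presented_group)
  then show "X \<otimes>\<^bsub>presented_group R\<^esub> Y \<in> carrier (presented_group R)"
    by (simp add: presented_group_def)
next
  fix X Y Z assume "X \<in> carrier (presented_group R)" "Y \<in> carrier (presented_group R)"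
    "Z \<in> carrier (presented_group R)"
  then obtain u v w where "X = word_class R u" "Y = word_class R v" "Z = word_class R w"
    by (auto simp: presented_group_def)
  then show "X \<otimes>\<^bsub>presented_group R\<^esub> Y \<otimes>\<^bsub>presented_group R\<^esub> Z
      = X \<otimes>\<^bsub>presented_group R\<^esub> (Y \<otimes>\<^bsub>presented_group R\<^esub> Z)"
    by (simp add: mult_presented_group)
next
  fix X assume "X \<in> carrier (presented_group R)"
  then obtain u where u: "X = word_class R u" by (auto simp: presented_group_def)
  have one: "\<one>\<^bsub>presented_group R\<^esub> = word_class R []" by (simp add: presented_group_def)
  show "\<one>\<^bsub>presented_group R\<^esub> \<otimes>\<^bsub>presented_group R\<^esub> X = X"
    by (simp add: u one mult_presented_group)
qed (simp add: presented_group_def)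


section \<open>The dihedral group\<close>

datatype dihedral_gen = Rot | Refl

definition dihedral_relations :: "nat \<Rightarrow> (dihedral_gen word \<times> dihedral_gen word) set" where
  "dihedral_relations n =
    {(replicate n (Rot, True), []),
     ([(Refl, True), (Refl, True)], []),
     ([(Refl, True), (Rot, True), (Refl, False)], [(Rot, False)])}"

definition dihedral_group :: "nat \<Rightarrow> dihedral_gen word set monoid" where
  "dihedral_group n = presented_group (dihedral_relations n)"

lemma group_dihedral_group: "group (dihedral_group n)"
  unfolding dihedral_group_def by (rule group_presented_group)

text \<open>
  The pair \<open>(i, s)\<close> represents \<open>a\<^sup>i\<close> if \<open>s\<close> is false and \<open>a\<^sup>i b\<close> otherwise;
  words act on such pairs by multiplication from the left.
\<close>

fun dihedral_act :: "dihedral_gen \<times> bool \<Rightarrow> int \<times> bool \<Rightarrow> int \<times> bool" where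
  "dihedral_act (Rot, True) (i, s) = (i + 1, s)"
| "dihedral_act (Rot, False) (i, s) = (i - 1, s)"
| "dihedral_act (Refl, _) (i, s) = (- i, \<not> s)"

definition dihedral_equiv :: "nat \<Rightarrow> int \<times> bool \<Rightarrow> int \<times> bool \<Rightarrow> bool" where
  "dihedral_equiv n p q \<longleftrightarrow> int n dvd fst p - fst q \<and> snd p = snd q"

lemma dihedral_equiv_trans:
  "dihedral_equiv n p q \<Longrightarrow> dihedral_equiv n q r \<Longrightarrow> dihedral_equiv n p r"
  unfolding dihedral_equiv_def using dvd_add[of "int n" "fst p - fst q" "fst q - fst r"] by simp

lemma dihedral_act_equiv:
  "dihedral_equiv n p q \<Longrightarrow> dihedral_equiv n (foldr dihedral_act u p) (foldr dihedral_act u q)"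
proof (induction u)
  case (Cons c u)
  obtain i s j t where *: "foldr dihedral_act u p = (i, s)" "foldr dihedral_act u q = (j, t)"
    by fastforce
  obtain x e where c: "c = (x, e)" by fastforce
  have "int n dvd j - i \<longleftrightarrow> int n dvd i - j" by (rule dvd_diff_commute)
  then show ?case using Cons * by (cases x; cases e) (auto simp: c dihedral_equiv_def)
qed simp

lemma funpow_dihedral_act: "(dihedral_act (Rot, True) ^^ k) (i, s) = (i + int k, s)"
  by (induction k) auto

lemma word_cong_dihedral_act:
  assumes "word_cong (dihedral_relations n) u v"
  shows "dihedral_equiv n (foldr dihedral_act u p) (foldr dihedral_act v p)"
  using assms
proof (induction arbitrary: p)
  case (refl u)
  then show ?case by (simp add: dihedral_equiv_def)
next
  case (sym u v)
  then show ?case by (simp add: dihedral_equiv_def dvd_diff_commute)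
next
  case (trans u v w)
  then show ?case by (blast intro: dihedral_equiv_trans)
next
  case (mult u u' v v')
  then show ?case by (simp, blast intro: dihedral_equiv_trans dihedral_act_equiv)
next
  case (cancel x s)
  then show ?case by (cases p; cases x; cases s) (auto simp: dihedral_equiv_def)
next
  case (relation u v)
  then show ?case
    by (cases p) (auto simp: dihedral_equiv_def dihedral_relations_def funpow_dihedral_act)
qed

definition dihedral_nf :: "nat \<times> bool \<Rightarrow> dihedral_gen word" where
  "dihedral_nf p = replicate (fst p) (Rot, True) @ (if snd p then [(Refl, True)] else [])"

lemma word_class_dihedral_nf:
  assumes "n \<ge> 1"
  shows "\<exists>i<n. \<exists>s. word_cong (dihedral_relations n) u (dihedral_nf (i, s))"
proof -
  let ?G = "dihedral_group n"
  interpret group ?G by (rule group_dihedral_group)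
  let ?c = "word_class (dihedral_relations n)"
  define a b where "a = ?c [(Rot, True)]" and "b = ?c [(Refl, True)]"
  have mult: "?c u \<otimes>\<^bsub>?G\<^esub> ?c v = ?c (u @ v)" for u v
    unfolding dihedral_group_def by (rule mult_presented_group)
  have one: "?c [] = \<one>\<^bsub>?G\<^esub>" by (simp add: dihedral_group_def presented_group_def)
  have cl: "?c u \<in> carrier ?G" for u by (simp add: dihedral_group_def presented_group_def)
  have ab: "a \<in> carrier ?G" "b \<in> carrier ?G" by (simp_all add: a_def b_def cl)
  have ia: "?c [(Rot, False)] = inv\<^bsub>?G\<^esub> a" and ib: "?c [(Refl, False)] = inv\<^bsub>?G\<^esub> b"
    by (rule inv_equality[symmetric];
        simp add: a_def b_def cl mult one[symmetric] word_class_eq_iff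
          word_cong.cancel[where s = False, simplified])+
  have pow: "?c (replicate k (Rot, True)) = a [^]\<^bsub>?G\<^esub> k" for k
  proof (induction k)
    case (Suc k)
    have "?c (replicate (Suc k) (Rot, True)) = ?c (replicate k (Rot, True)) \<otimes>\<^bsub>?G\<^esub> a"
      by (simp add: a_def mult replicate_append_same)
    then show ?case using Suc by simp
  qed (simp add: one)
  have an: "a [^]\<^bsub>?G\<^esub> n = \<one>\<^bsub>?G\<^esub>"
    by (simp add: pow[symmetric] one[symmetric] word_class_eq_iff)
       (simp add: word_cong.relation dihedral_relations_def)
  have "?c [(Refl, True), (Refl, True)] = ?c []"
    unfolding word_class_eq_iff by (rule word_cong.relation) (simp add: dihedral_relations_def)
  then have bb: "b \<otimes>\<^bsub>?G\<^esub> b = \<one>\<^bsub>?G\<^esub>" by (simp add: b_def mult one)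
  then have ibb: "inv\<^bsub>?G\<^esub> b = b" using ab by (simp add: inv_equality)
  have "?c [(Refl, True), (Rot, True), (Refl, False)] = ?c [(Rot, False)]"
    unfolding word_class_eq_iff by (rule word_cong.relation) (simp add: dihedral_relations_def)
  moreover have "?c [(Refl, True), (Rot, True), (Refl, False)] = b \<otimes>\<^bsub>?G\<^esub> a \<otimes>\<^bsub>?G\<^esub> inv\<^bsub>?G\<^esub> b"
    by (simp add: a_def b_def mult ib[symmetric, unfolded b_def])
  ultimately have rel: "b \<otimes>\<^bsub>?G\<^esub> a \<otimes>\<^bsub>?G\<^esub> b = inv\<^bsub>?G\<^esub> a" by (simp add: ia ibb)
  have comm: "b \<otimes>\<^bsub>?G\<^esub> a = inv\<^bsub>?G\<^esub> a \<otimes>\<^bsub>?G\<^esub> b"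
    using ab bb by (simp add: rel[symmetric] m_assoc)
  have comm': "b \<otimes>\<^bsub>?G\<^esub> a [^]\<^bsub>?G\<^esub> k = inv\<^bsub>?G\<^esub> (a [^]\<^bsub>?G\<^esub> k) \<otimes>\<^bsub>?G\<^esub> b" for k :: nat
  proof (induction k)
    case (Suc k)
    have "b \<otimes>\<^bsub>?G\<^esub> a [^]\<^bsub>?G\<^esub> Suc k = (b \<otimes>\<^bsub>?G\<^esub> a [^]\<^bsub>?G\<^esub> k) \<otimes>\<^bsub>?G\<^esub> a"
      using ab by (simp add: m_assoc)
    also have "\<dots> = inv\<^bsub>?G\<^esub> (a [^]\<^bsub>?G\<^esub> k) \<otimes>\<^bsub>?G\<^esub> (b \<otimes>\<^bsub>?G\<^esub> a)" using ab by (simp add: Suc m_assoc)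
    also have "\<dots> = (inv\<^bsub>?G\<^esub> (a [^]\<^bsub>?G\<^esub> k) \<otimes>\<^bsub>?G\<^esub> inv\<^bsub>?G\<^esub> a) \<otimes>\<^bsub>?G\<^esub> b"
      using ab by (simp add: comm m_assoc)
    also have "inv\<^bsub>?G\<^esub> (a [^]\<^bsub>?G\<^esub> k) \<otimes>\<^bsub>?G\<^esub> inv\<^bsub>?G\<^esub> a = inv\<^bsub>?G\<^esub> (a [^]\<^bsub>?G\<^esub> Suc k)"
      using ab nat_pow_Suc2 by (metis inv_mult_group nat_pow_closed)
    finally show ?case .
  qed (use ab in simp)
  have red: "\<exists>i<n. a [^]\<^bsub>?G\<^esub> k = a [^]\<^bsub>?G\<^esub> i" for k :: nat
  proof (intro exI conjI)
    show "k mod n < n" using assms by simp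
    have "a [^]\<^bsub>?G\<^esub> k = a [^]\<^bsub>?G\<^esub> (n * (k div n) + k mod n)" by simp
    also have "\<dots> = (a [^]\<^bsub>?G\<^esub> n) [^]\<^bsub>?G\<^esub> (k div n) \<otimes>\<^bsub>?G\<^esub> a [^]\<^bsub>?G\<^esub> (k mod n)"
      using ab by (simp add: nat_pow_mult nat_pow_pow)
    finally show "a [^]\<^bsub>?G\<^esub> k = a [^]\<^bsub>?G\<^esub> (k mod n)" using ab by (simp add: an)
  qed
  have inv_red: "inv\<^bsub>?G\<^esub> (a [^]\<^bsub>?G\<^esub> i) = a [^]\<^bsub>?G\<^esub> (n - i)" if "i \<le> n" for i
    using that ab by (intro inv_equality) (simp_all add: nat_pow_mult an)
  define N where "N s k = a [^]\<^bsub>?G\<^esub> k \<otimes>\<^bsub>?G\<^esub> (if s then b else \<one>\<^bsub>?G\<^esub>)" for s and k :: nat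
  have nf: "?c (dihedral_nf (k, s)) = N s k" for k s
  proof (cases s)
    case True
    then have "?c (dihedral_nf (k, s)) = ?c (replicate k (Rot, True)) \<otimes>\<^bsub>?G\<^esub> b"
      by (simp only: b_def mult dihedral_nf_def fst_conv snd_conv if_True)
    then show ?thesis using True by (simp add: N_def pow)
  next
    case False
    then show ?thesis using ab by (simp add: N_def pow dihedral_nf_def)
  qed
  have "\<exists>i<n. \<exists>s. ?c u = N s i"
  proof (induction u)
    case Nil
    have "?c [] = N False 0" by (simp add: N_def one)
    then show ?case using assms by (intro exI[of _ 0] conjI exI[of _ False]) auto
  next
    case (Cons c u)
    then obtain i s where IH: "i < n" "?c u = N s i" by blast
    have "?c (c # u) = ?c [c] \<otimes>\<^bsub>?G\<^esub> N s i" by (simp add: IH(2)[symmetric] mult)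
    moreover have "\<exists>k s. ?c [c] \<otimes>\<^bsub>?G\<^esub> N s' i = N s k" for s'
    proof (cases "fst c")
      case Rot
      have "\<exists>m::nat. ?c [c] = a [^]\<^bsub>?G\<^esub> m"
      proof (cases "snd c")
        case True
        then have "?c [c] = a [^]\<^bsub>?G\<^esub> (1::nat)" using Rot ab by (cases c) (simp add: a_def[symmetric])
        then show ?thesis ..
      next
        case False
        then have "?c [c] = a [^]\<^bsub>?G\<^esub> (n - 1)"
          using Rot ab assms inv_red[of 1] by (cases c) (simp add: ia)
        then show ?thesis ..
      qed
      then obtain m :: nat where "?c [c] = a [^]\<^bsub>?G\<^esub> m" ..
      then have "?c [c] \<otimes>\<^bsub>?G\<^esub> N s' i = N s' (m + i)"
        using ab by (simp add: N_def m_assoc[symmetric] nat_pow_mult)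
      then show ?thesis by blast
    next
      case Refl
      then have "?c [c] = b" by (cases c; cases "snd c") (auto simp: b_def[symmetric] ib ibb)
      then have "?c [c] \<otimes>\<^bsub>?G\<^esub> N s' i
          = (b \<otimes>\<^bsub>?G\<^esub> a [^]\<^bsub>?G\<^esub> i) \<otimes>\<^bsub>?G\<^esub> (if s' then b else \<one>\<^bsub>?G\<^esub>)"
        using ab by (simp add: N_def m_assoc)
      also have "\<dots> = N (\<not> s') (n - i)"
        using ab IH(1) by (simp add: comm' inv_red N_def m_assoc bb)
      finally show ?thesis by blast
    qed
    ultimately obtain k s' where k: "?c (c # u) = N s' k" by metis
    obtain j where "j < n" "a [^]\<^bsub>?G\<^esub> k = a [^]\<^bsub>?G\<^esub> j" using red[of k] by auto
    then have "j < n \<and> ?c (c # u) = N s' j" by (simp add: k N_def)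
    then show ?case by blast
  qed
  then show ?thesis by (simp add: nf[symmetric] word_class_eq_iff)
qed

lemma order_dihedral_group:
  assumes "n \<ge> 1"
  shows "order (dihedral_group n) = 2 * n"
proof -
  let ?f = "\<lambda>p. word_class (dihedral_relations n) (dihedral_nf p)"
  have act: "foldr dihedral_act (dihedral_nf p) (0, False) = (int (fst p), snd p)" for p
    by (simp add: dihedral_nf_def funpow_dihedral_act)
  have "inj_on ?f ({..<n} \<times> UNIV)"
  proof (rule inj_onI)
    fix p q assume pq: "p \<in> {..<n} \<times> UNIV" "q \<in> {..<n} \<times> UNIV" "?f p = ?f q"
    then have "dihedral_equiv n (int (fst p), snd p) (int (fst q), snd q)"
      using word_cong_dihedral_act[of n "dihedral_nf p" "dihedral_nf q" "(0, False)"]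
      by (simp add: act word_class_eq_iff)
    then have "int (fst p) mod int n = int (fst q) mod int n" "snd p = snd q"
      by (auto simp: dihedral_equiv_def mod_eq_dvd_iff)
    then show "p = q" using pq by (auto simp: prod_eq_iff)
  qed
  moreover have "?f ` ({..<n} \<times> UNIV) = carrier (dihedral_group n)"
  proof
    show "carrier (dihedral_group n) \<subseteq> ?f ` ({..<n} \<times> UNIV)"
    proof
      fix X assume "X \<in> carrier (dihedral_group n)"
      then obtain u where "X = word_class (dihedral_relations n) u"
        by (auto simp: dihedral_group_def presented_group_def)
      then show "X \<in> ?f ` ({..<n} \<times> UNIV)"
        using word_class_dihedral_nf[OF assms, of u] by (auto simp: word_class_eq_iff image_iff)
    qed
  qed (auto simp: dihedral_group_def presented_group_def)
  ultimately have "card (carrier (dihedral_group n)) = card ({..<n} \<times> (UNIV :: bool set))"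
    by (metis card_image)
  then show ?thesis by (simp add: order_def card_cartesian_product)
qed


section \<open>Hypertrees and star hypergraphs\<close>

text \<open>A graph is given by its vertex set and its set of two-element edges.\<close>

definition simple_graph :: "'v set \<Rightarrow> 'v set set \<Rightarrow> bool" where
  "simple_graph X E \<longleftrightarrow> (\<forall>e\<in>E. e \<subseteq> X \<and> card e = 2)"

definition connected_graph :: "'v set \<Rightarrow> 'v set set \<Rightarrow> bool" where
  "connected_graph X E \<longleftrightarrow>
    X \<noteq> {} \<and> (\<forall>u\<in>X. \<forall>v\<in>X. (u, v) \<in> {(x, y). {x, y} \<in> E}\<^sup>*)"

definition graph_cycle :: "'v set set \<Rightarrow> 'v list \<Rightarrow> bool" where
  "graph_cycle E c \<longleftrightarrow> length c \<ge> 3 \<and> distinct c \<and>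
    (\<forall>i<length c. {c ! i, c ! (Suc i mod length c)} \<in> E)"

definition tree_graph :: "'v set \<Rightarrow> 'v set set \<Rightarrow> bool" where
  "tree_graph X E \<longleftrightarrow> simple_graph X E \<and> connected_graph X E \<and> (\<nexists>c. graph_cycle E c)"

definition induced_edges :: "'v set set \<Rightarrow> 'v set \<Rightarrow> 'v set set" where
  "induced_edges E D = {e \<in> E. e \<subseteq> D}"

text \<open>A hypergraph is a pair of its vertex set and its set of hyperedges.\<close>

type_synonym 'v hypergraph = "'v set \<times> 'v set set"

definition hypertree :: "'v hypergraph \<Rightarrow> bool" where
  "hypertree \<H> \<longleftrightarrow>
    (\<exists>E. tree_graph (fst \<H>) E \<and> (\<forall>D\<in>snd \<H>. connected_graph D (induced_edges E D)))"

definition star_hypergraph :: "'v hypergraph \<Rightarrow> bool" where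
  "star_hypergraph \<H> \<longleftrightarrow> (\<exists>x\<in>fst \<H>. \<forall>D\<in>snd \<H>. x \<in> D)"


section \<open>The co-maximal hypergraph of a group\<close>

definition nontrivial_proper_subgroups :: "('a, 'm) monoid_scheme \<Rightarrow> 'a set set" where
  "nontrivial_proper_subgroups G = {H. subgroup H G \<and> H \<noteq> {\<one>\<^bsub>G\<^esub>} \<and> H \<noteq> carrier G}"

definition comaximal_vertices :: "('a, 'm) monoid_scheme \<Rightarrow> 'a set set" where
  "comaximal_vertices G =
    {H \<in> nontrivial_proper_subgroups G.
      \<exists>K\<in>nontrivial_proper_subgroups G. H <#>\<^bsub>G\<^esub> K = carrier G}"

definition pairwise_comaximal :: "('a, 'm) monoid_scheme \<Rightarrow> 'a set set \<Rightarrow> bool" where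
  "pairwise_comaximal G E \<longleftrightarrow> (\<forall>H\<in>E. \<forall>K\<in>E. H \<noteq> K \<longrightarrow> H <#>\<^bsub>G\<^esub> K = carrier G)"

definition comaximal_hypergraph :: "('a, 'm) monoid_scheme \<Rightarrow> 'a set hypergraph" where
  "comaximal_hypergraph G =
    (comaximal_vertices G,
     {E. E \<subseteq> comaximal_vertices G \<and> pairwise_comaximal G E \<and>
         \<not> (\<exists>E'\<subseteq>comaximal_vertices G. E \<subset> E' \<and> pairwise_comaximal G E')})"

end

theory Submission
  imports Defs
begin

text \<open>
  The rotation subgroup \<open>C = \<langle>a\<rangle>\<close> is comaximal with every subgroup containing a reflection.  If \<open>n\<close> is
  a prime power, it is the only vertex made of rotations, so it lies in all hyperedges; and a common
  vertex of all hyperedges is the centre of a star that serves as host tree.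

  If \<open>n\<close> is not a prime power, write \<open>n = q\<^sup>\<beta> d\<close> with \<open>q\<close> an odd prime, \<open>q \<nmid> d\<close> and \<open>d > 1\<close>.  Then
  \<open>{\<langle>a\<^sup>d\<rangle>, \<langle>a\<^sup>q, a\<^sup>j b\<rangle>}\<close> is a hyperedge for \<open>j = 0, 1\<close>, hence an edge of any host tree.  The hyperedges
  containing \<open>C\<close> and one of the two subgroups \<open>\<langle>a\<^sup>q, a\<^sup>j b\<rangle>\<close> avoid \<open>\<langle>a\<^sup>d\<rangle>\<close> and connect these two neighbours
  of \<open>\<langle>a\<^sup>d\<rangle>\<close>, which closes a cycle.
\<close>

section \<open>Trees and star hypergraphs\<close>

text \<open>Induction over the walk: if its new end point was visited before, the list is cut right
  after that visit. The bound on \<open>set c\<close> lets a condition on the targets of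
  \<open>r\<close> control every vertex after \<open>y\<close>.\<close>

lemma rtrancl_imp_distinct_path:
  assumes "(y, z) \<in> r\<^sup>*"
  shows "\<exists>c. c \<noteq> [] \<and> hd c = y \<and> last c = z \<and> distinct c \<and> set c \<subseteq> insert y (Range r) \<and>
    (\<forall>i. Suc i < length c \<longrightarrow> (c ! i, c ! Suc i) \<in> r)"
  using assms
proof (induction rule: rtrancl_induct)
  case base
  show ?case by (intro exI[of _ "[y]"]) auto
next
  case (step w z)
  then obtain c where c: "c \<noteq> []" "hd c = y" "last c = w" "distinct c" "set c \<subseteq> insert y (Range r)"
    "\<And>i. Suc i < length c \<Longrightarrow> (c ! i, c ! Suc i) \<in> r"
    by blast
  show ?case
  proof (cases "z \<in> set c")
    case True
    then obtain k where k: "k < length c" "c ! k = z" by (auto simp: in_set_conv_nth)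
    let ?c = "take (Suc k) c"
    have "last ?c = z" using k c(1) by (simp add: take_Suc_conv_app_nth)
    moreover have "set ?c \<subseteq> insert y (Range r)" using c(5) set_take_subset by fast
    ultimately show ?thesis using c k by (intro exI[of _ ?c]) auto
  next
    case False
    have "((c @ [z]) ! i, (c @ [z]) ! Suc i) \<in> r" if "Suc i < length (c @ [z])" for i
    proof (cases "Suc i < length c")
      case True
      then show ?thesis using c(6) by (simp add: nth_append)
    next
      case 2: False
      then have "i = length c - 1" using that by simp
      then show ?thesis using c(1,3) step.hyps(2) by (simp add: nth_append last_conv_nth)
    qed
    moreover have "z \<in> Range r" using step.hyps(2) by blast
    ultimately show ?thesis using c False by (intro exI[of _ "c @ [z]"]) auto
  qed
qed

text \<open>Putting \<open>x\<close> in front of a duplicate-free path from \<open>y\<close> to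
  \<open>z\<close> closes a cycle. The path misses \<open>x\<close>, because it starts at
  \<open>y\<close> and no step leads to \<open>x\<close>.\<close>

lemma graph_cycle_through:
  assumes edges: "{x, y} \<in> E" "{x, z} \<in> E" and "y \<noteq> z" "x \<noteq> y"
    and path: "(y, z) \<in> {(u, v). {u, v} \<in> E \<and> v \<noteq> x}\<^sup>*"
  shows "\<exists>c. graph_cycle E c"
proof -
  obtain c where c: "c \<noteq> []" "hd c = y" "last c = z" "distinct c"
    "set c \<subseteq> insert y (Range {(u, v). {u, v} \<in> E \<and> v \<noteq> x})"
    "\<And>i. Suc i < length c \<Longrightarrow> (c ! i, c ! Suc i) \<in> {(u, v). {u, v} \<in> E \<and> v \<noteq> x}"
    using rtrancl_imp_distinct_path[OF path] by blast
  have x: "x \<notin> set c" using c(5) \<open>x \<noteq> y\<close> by auto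
  have len: "length c \<ge> 2" using c(1-3) \<open>y \<noteq> z\<close> by (cases c; cases "tl c") auto
  have "{(x # c) ! i, (x # c) ! (Suc i mod length (x # c))} \<in> E" if i: "i < length (x # c)" for i
  proof -
    \<comment> \<open>The edge from \<open>x\<close> to \<open>y\<close>, an edge of the path, and
      the closing edge from \<open>z\<close> back to \<open>x\<close>.\<close>
    consider "i = 0" | k where "i = Suc k" "Suc k < length c" | k where "i = Suc k" "Suc k = length c"
      using i by (cases i) (auto, metis Suc_lessI)
    then show ?thesis
    proof cases
      case 1
      then show ?thesis using c(1,2) edges(1) by (simp add: hd_conv_nth)
    next
      case 2
      then show ?thesis using c(6)[of k] by simp
    next
      case 3
      then have "c ! k = z" using c(1,3) by (metis diff_Suc_1 last_conv_nth)
      then show ?thesis using 3(1) 3(2)[symmetric] edges(2) by (simp add: insert_commute)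
    qed
  qed
  then have "graph_cycle E (x # c)" unfolding graph_cycle_def using x c(4) len by auto
  then show ?thesis ..
qed

text \<open>A path from \<open>x\<close> to \<open>y\<close> must start with an edge inside
  \<open>{x, y}\<close>, and a simple graph has no loops. So a hyperedge with two vertices is an
  edge of every host tree.\<close>

lemma connected_induced_pair:
  assumes "connected_graph {x, y} (induced_edges E {x, y})" "x \<noteq> y" "simple_graph X E"
  shows "{x, y} \<in> E"
proof -
  have "(x, y) \<in> {(u, v). {u, v} \<in> induced_edges E {x, y}}\<^sup>*"
    using assms(1) by (simp add: connected_graph_def)
  then obtain w where w: "{x, w} \<in> E" "{x, w} \<subseteq> {x, y}"
    using \<open>x \<noteq> y\<close> by (auto simp: induced_edges_def elim: converse_rtranclE)
  then have "card {x, w} = 2" using assms(3) by (auto simp: simple_graph_def)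
  then have "w \<noteq> x" by auto
  then show ?thesis using w by auto
qed

text \<open>Hyperedges that miss \<open>x\<close> supply the paths around \<open>x\<close> needed in
  \<open>graph_cycle_through\<close>.\<close>

lemma connected_induced_avoiding:
  assumes "connected_graph D (induced_edges E D)" "u \<in> D" "v \<in> D" "x \<notin> D"
  shows "(u, v) \<in> {(u, v). {u, v} \<in> E \<and> v \<noteq> x}\<^sup>*"
proof -
  have "(u, v) \<in> {(u, v). {u, v} \<in> induced_edges E D}\<^sup>*"
    using assms by (simp add: connected_graph_def)
  moreover have "{(u, v). {u, v} \<in> induced_edges E D} \<subseteq> {(u, v). {u, v} \<in> E \<and> v \<noteq> x}"
    using assms(4) by (auto simp: induced_edges_def)
  ultimately show ?thesis using rtrancl_mono by blast
qed

lemma connected_star: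
  assumes "x \<in> D" "\<And>y. y \<in> D \<Longrightarrow> y \<noteq> x \<Longrightarrow> {x, y} \<in> E"
  shows "connected_graph D E"
proof -
  let ?r = "{(u, v). {u, v} \<in> E}"
  have "(x, y) \<in> ?r\<^sup>*" "(y, x) \<in> ?r\<^sup>*" if "y \<in> D" for y
    using assms(2)[OF that] by (cases "y = x"; auto simp: insert_commute intro!: r_into_rtrancl)+
  then show ?thesis using assms(1) unfolding connected_graph_def by (blast intro: rtrancl_trans)
qed

text \<open>The first two edges of a cycle share only its second vertex, so that vertex would be
  \<open>x\<close>; but the third edge misses it.\<close>

lemma no_cycle_if_common_vertex:
  assumes "\<And>e. e \<in> E \<Longrightarrow> x \<in> e"
  shows "\<not> graph_cycle E c"
proof
  assume cyc: "graph_cycle E c"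
  then have len: "length c \<ge> 3" and d: "distinct c" by (auto simp: graph_cycle_def)
  have x: "x \<in> {c ! i, c ! (Suc i mod length c)}" if "i < length c" for i
    using cyc assms that by (auto simp: graph_cycle_def)
  obtain u v w cs where c: "c = u # v # w # cs"
    using len by (auto simp: numeral_3_eq_3 Suc_le_length_iff)
  have "x \<in> {u, v}" "x \<in> {v, w}" using x[of 0] x[of 1] by (auto simp: c)
  then have "x = v" using d by (auto simp: c)
  moreover have "x \<in> {c ! 2, c ! (3 mod length c)}" using x[of 2] len by simp
  moreover have "c ! 2 = w" by (simp add: c)
  \<comment> \<open>In a triangle the third edge returns to \<open>u\<close>; in a longer cycle it
    leads to the head of \<open>cs\<close>.\<close>
  moreover have "c ! (3 mod length c) \<in> insert u (set cs)"
  proof (cases cs)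
    case Nil
    then have "length c = 3" by (simp add: c)
    then show ?thesis by (simp add: c)
  next
    case (Cons y ys)
    then have "3 mod length c = 3" using mod_less[of 3 "length c"] by (simp add: c)
    then show ?thesis by (simp add: c Cons)
  qed
  ultimately show False using d by (auto simp: c)
qed

lemma star_hypergraph_imp_hypertree:
  assumes "star_hypergraph \<H>" and sub: "\<And>D. D \<in> snd \<H> \<Longrightarrow> D \<subseteq> fst \<H>"
  shows "hypertree \<H>"
proof -
  obtain x where x: "x \<in> fst \<H>" "\<And>D. D \<in> snd \<H> \<Longrightarrow> x \<in> D"
    using assms(1) by (auto simp: star_hypergraph_def)
  define E where "E = {{x, y} | y. y \<in> fst \<H> \<and> y \<noteq> x}"
  have "tree_graph (fst \<H>) E"
    unfolding tree_graph_def
  proof (intro conjI)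
    show "simple_graph (fst \<H>) E" using x(1) by (auto simp: simple_graph_def E_def)
    show "connected_graph (fst \<H>) E" using x(1) by (intro connected_star[of x]) (auto simp: E_def)
    show "\<nexists>c. graph_cycle E c" using no_cycle_if_common_vertex[of E x] by (auto simp: E_def)
  qed
  moreover have "connected_graph D (induced_edges E D)" if "D \<in> snd \<H>" for D
    using x(2)[OF that] sub[OF that] by (intro connected_star[of x]) (auto simp: E_def induced_edges_def)
  ultimately show ?thesis by (auto simp: hypertree_def)
qed

section \<open>Comaximal subgroups\<close>

lemma set_multI: "h \<in> H \<Longrightarrow> k \<in> K \<Longrightarrow> h \<otimes>\<^bsub>G\<^esub> k \<in> H <#>\<^bsub>G\<^esub> K"
  by (auto simp: set_mult_def)

lemma set_multE:
  assumes "x \<in> H <#>\<^bsub>G\<^esub> K"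
  obtains h k where "h \<in> H" "k \<in> K" "x = h \<otimes>\<^bsub>G\<^esub> k"
  using assms by (auto simp: set_mult_def)

text \<open>Inverting a factorisation of \<open>inv g\<close> reverses the order of its
  factors.\<close>

lemma (in group) set_mult_eq_carrier_commute:
  assumes "subgroup H G" "subgroup K G" "H <#> K = carrier G"
  shows "K <#> H = carrier G"
proof
  show "K <#> H \<subseteq> carrier G"
    using assms(1,2) by (auto simp: set_mult_def dest: subgroup.mem_carrier)
  show "carrier G \<subseteq> K <#> H"
  proof
    fix g assume g: "g \<in> carrier G"
    then obtain h k where hk: "h \<in> H" "k \<in> K" "inv g = h \<otimes> k"
      using assms(3) inv_closed[OF g] by (metis set_multE)
    have "h \<in> carrier G" "k \<in> carrier G" using hk assms(1,2) by (auto dest: subgroup.mem_carrier)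
    then have "g = inv k \<otimes> inv h" using g hk(3) by (metis inv_inv inv_mult_group)
    moreover have "inv k \<in> K" "inv h \<in> H"
      using hk assms(1,2) by (simp_all add: subgroup.m_inv_closed)
    ultimately show "g \<in> K <#> H" by (simp add: set_multI)
  qed
qed

lemma pairwise_comaximal_pairI:
  assumes "group G" "subgroup H G" "subgroup K G" "H <#>\<^bsub>G\<^esub> K = carrier G"
  shows "pairwise_comaximal G {H, K}"
  using assms(4) group.set_mult_eq_carrier_commute[OF assms] unfolding pairwise_comaximal_def by blast

text \<open>Finiteness of the group leaves finitely many pairwise comaximal families, so one that is
  maximal above \<open>A\<close> exists.\<close>

lemma comaximal_hyperedge_extension:
  assumes "finite (carrier G)" "A \<subseteq> comaximal_vertices G" "pairwise_comaximal G A"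
  shows "\<exists>D\<in>snd (comaximal_hypergraph G). A \<subseteq> D"
proof -
  let ?F = "{D. D \<subseteq> comaximal_vertices G \<and> pairwise_comaximal G D}"
  have "comaximal_vertices G \<subseteq> Pow (carrier G)"
    by (auto simp: comaximal_vertices_def nontrivial_proper_subgroups_def dest: subgroup.mem_carrier)
  then have "finite (comaximal_vertices G)" using assms(1) by (meson finite_Pow_iff finite_subset)
  then have "finite ?F" by (auto intro: finite_subset[of _ "Pow (comaximal_vertices G)"])
  then obtain D where "D \<in> ?F" "A \<subseteq> D" "\<forall>D'\<in>?F. D \<subseteq> D' \<longrightarrow> D = D'"
    using finite_has_maximal2[of ?F A] assms(2,3) by auto
  then show ?thesis by (intro bexI[of _ D]) (auto simp: comaximal_hypergraph_def)
qed

text \<open>A hyperedge without \<open>C\<close> could be enlarged by \<open>C\<close>, against its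
  maximality.\<close>

lemma comaximal_star:
  assumes "group G" "C \<in> comaximal_vertices G"
    and "\<And>H. H \<in> comaximal_vertices G \<Longrightarrow> H \<noteq> C \<Longrightarrow> C <#>\<^bsub>G\<^esub> H = carrier G"
  shows "star_hypergraph (comaximal_hypergraph G)"
proof -
  have "C \<in> D" if D: "D \<in> snd (comaximal_hypergraph G)" for D
  proof (rule ccontr)
    assume "C \<notin> D"
    have V: "D \<subseteq> comaximal_vertices G" "pairwise_comaximal G D"
      using D by (auto simp: comaximal_hypergraph_def)
    have "C <#>\<^bsub>G\<^esub> H = carrier G \<and> H <#>\<^bsub>G\<^esub> C = carrier G" if "H \<in> D" for H
    proof -
      have "C <#>\<^bsub>G\<^esub> H = carrier G" using assms(3) that V(1) \<open>C \<notin> D\<close> by blast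
      moreover have "subgroup C G" "subgroup H G"
        using assms(2) V(1) that by (auto simp: comaximal_vertices_def nontrivial_proper_subgroups_def)
      ultimately show ?thesis using group.set_mult_eq_carrier_commute[OF assms(1)] by blast
    qed
    then have "pairwise_comaximal G (insert C D)" using V(2) by (auto simp: pairwise_comaximal_def)
    moreover have "D \<subset> insert C D" using \<open>C \<notin> D\<close> by blast
    ultimately show False using D V(1) assms(2) by (auto simp: comaximal_hypergraph_def)
  qed
  then show ?thesis using assms(2) by (auto simp: star_hypergraph_def comaximal_hypergraph_def)
qed

section \<open>Subgroups of dihedral groups\<close>

text \<open>The element \<open>elem i s\<close> stands for \<open>a\<^sup>i\<close> if \<open>s\<close> is false and for \<open>a\<^sup>i b\<close> otherwise.\<close>

locale dihedral = group G for G (structure) +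
  fixes n :: nat and elem :: "int \<Rightarrow> bool \<Rightarrow> 'a"
  assumes n_ge_2: "n \<ge> 2"
    and carrier_eq: "carrier G = range (\<lambda>(i, s). elem i s)"
    and elem_mult: "elem i s \<otimes> elem j t = elem (if s then i - j else i + j) (s \<noteq> t)"
    and elem_eq_iff: "elem i s = elem j t \<longleftrightarrow> int n dvd i - j \<and> s = t"
begin

lemma elem_closed [simp]: "elem i s \<in> carrier G"
  by (auto simp: carrier_eq)

lemma carrierE:
  assumes "x \<in> carrier G"
  obtains i s where "x = elem i s"
  using assms by (auto simp: carrier_eq)

lemma one_eq: "\<one> = elem 0 False"
proof -
  have "elem 0 False \<otimes> elem 0 False = elem 0 False" by (simp add: elem_mult)
  then show ?thesis by (metis elem_closed l_cancel_one)
qed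

lemma inv_elem: "inv (elem i s) = elem (if s then i else - i) s"
  by (rule inv_equality) (auto simp: elem_mult one_eq)

lemma finite_carrier: "finite (carrier G)"
proof -
  have "carrier G \<subseteq> (\<lambda>(i, s). elem i s) ` ({0..<int n} \<times> UNIV)"
  proof
    fix x assume "x \<in> carrier G"
    then obtain i s where x: "x = elem i s" by (rule carrierE)
    have "x = elem (i mod int n) s" by (simp add: x elem_eq_iff)
    then show "x \<in> (\<lambda>(i, s). elem i s) ` ({0..<int n} \<times> UNIV)" using n_ge_2 by force
  qed
  then show ?thesis by (rule finite_subset) simp
qed

section \<open>Rotation subgroups and subgroups containing reflections\<close>

definition rotations :: "int \<Rightarrow> 'a set" where
  "rotations d = {elem i False | i. d dvd i}"

text \<open>The subgroup generated by \<open>a^d\<close> and \<open>a^j b\<close>: the exponents of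
  its reflections are those congruent to \<open>j\<close> modulo \<open>d\<close>.\<close>

definition dihedral_subgroup :: "int \<Rightarrow> int \<Rightarrow> 'a set" where
  "dihedral_subgroup d j = {elem i s | i s. d dvd (if s then i - j else i)}"

lemma rotationsI: "d dvd i \<Longrightarrow> elem i False \<in> rotations d"
  unfolding rotations_def by blast

lemma rotationsE:
  assumes "x \<in> rotations d"
  obtains i where "x = elem i False" "d dvd i"
  using assms unfolding rotations_def by blast

lemma dihedral_subgroupI: "d dvd (if s then i - j else i) \<Longrightarrow> elem i s \<in> dihedral_subgroup d j"
  unfolding dihedral_subgroup_def by blast

lemma dihedral_subgroupE:
  assumes "x \<in> dihedral_subgroup d j"
  obtains i s where "x = elem i s" "d dvd (if s then i - j else i)"
  using assms unfolding dihedral_subgroup_def by blast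

text \<open>An exponent is determined only modulo \<open>n\<close>; as \<open>d\<close> divides
  \<open>n\<close>, divisibility by \<open>d\<close> is the same for all representatives.\<close>

lemma elem_in_rotations_iff:
  assumes "d dvd int n"
  shows "elem i s \<in> rotations d \<longleftrightarrow> \<not> s \<and> d dvd i"
proof
  assume "elem i s \<in> rotations d"
  then obtain k where k: "elem i s = elem k False" "d dvd k" by (rule rotationsE)
  then have "d dvd i - k" using assms by (auto simp: elem_eq_iff)
  then have "d dvd (i - k) + k" using k(2) by (rule dvd_add)
  then show "\<not> s \<and> d dvd i" using k(1) by (simp add: elem_eq_iff)
qed (simp add: rotationsI)

lemma elem_in_dihedral_subgroup_iff:
  assumes "d dvd int n"
  shows "elem i s \<in> dihedral_subgroup d j \<longleftrightarrow> d dvd (if s then i - j else i)"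
proof
  assume "elem i s \<in> dihedral_subgroup d j"
  then obtain k t where kt: "elem i s = elem k t" "d dvd (if t then k - j else k)"
    by (rule dihedral_subgroupE)
  then have k: "elem i s = elem k s" "d dvd (if s then k - j else k)"
    by (simp_all add: elem_eq_iff)
  then have "d dvd i - k" using assms by (auto simp: elem_eq_iff)
  then have "d dvd (i - k) + (if s then k - j else k)" using k(2) by (rule dvd_add)
  then show "d dvd (if s then i - j else i)" by (auto split: if_splits)
qed (rule dihedral_subgroupI)

lemma rotations_subset_1: "rotations d \<subseteq> rotations 1"
  by (auto elim!: rotationsE intro: rotationsI)

lemma subgroup_rotations: "subgroup (rotations d) G"
proof (rule subgroupI)
  have "elem 0 False \<in> rotations d" by (simp add: rotationsI)
  then show "rotations d \<noteq> {}" by blast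
  show "rotations d \<subseteq> carrier G" by (auto elim!: rotationsE)
next
  fix x assume "x \<in> rotations d"
  then obtain i where "x = elem i False" "d dvd i" by (rule rotationsE)
  then show "inv x \<in> rotations d" by (simp add: inv_elem rotationsI)
next
  fix x y assume "x \<in> rotations d" "y \<in> rotations d"
  then obtain i j where "x = elem i False" "d dvd i" "y = elem j False" "d dvd j"
    by (meson rotationsE)
  then show "x \<otimes> y \<in> rotations d" by (simp add: elem_mult rotationsI)
qed

lemma subgroup_dihedral_subgroup:
  assumes "d dvd int n"
  shows "subgroup (dihedral_subgroup d j) G"
proof (rule subgroupI)
  show "dihedral_subgroup d j \<subseteq> carrier G" by (auto elim!: dihedral_subgroupE)
  have "elem 0 False \<in> dihedral_subgroup d j" by (simp add: elem_in_dihedral_subgroup_iff[OF assms])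
  then show "dihedral_subgroup d j \<noteq> {}" by blast
next
  fix x assume "x \<in> dihedral_subgroup d j"
  then obtain i s where "x = elem i s" "d dvd (if s then i - j else i)"
    by (rule dihedral_subgroupE)
  then show "inv x \<in> dihedral_subgroup d j"
    by (cases s) (simp_all add: inv_elem elem_in_dihedral_subgroup_iff[OF assms])
next
  fix x y assume "x \<in> dihedral_subgroup d j" "y \<in> dihedral_subgroup d j"
  then obtain i s k t where *: "x = elem i s" "d dvd (if s then i - j else i)"
      "y = elem k t" "d dvd (if t then k - j else k)"
    by (meson dihedral_subgroupE)
  \<comment> \<open>In each of the four cases the tested number is the sum (\<open>s\<close> false)
    or the difference (\<open>s\<close> true) of the two given multiples of
    \<open>d\<close>.\<close>
  have "d dvd (if s \<noteq> t then (if s then i - k else i + k) - j else (if s then i - k else i + k))"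
    using dvd_add[OF *(2,4)] dvd_diff[OF *(2,4)]
    by (cases s; cases t) (auto simp: algebra_simps)
  then show "x \<otimes> y \<in> dihedral_subgroup d j"
    by (simp add: * elem_mult elem_in_dihedral_subgroup_iff[OF assms])
qed

section \<open>Comaximality with the full rotation subgroup\<close>

lemma reflection_exponent:
  assumes "subgroup H G" "\<not> H \<subseteq> rotations 1"
  obtains k where "elem k True \<in> H"
proof -
  obtain h where h: "h \<in> H" "h \<notin> rotations 1" using assms(2) by blast
  obtain k s where k: "h = elem k s" using subgroup.mem_carrier[OF assms(1) h(1)] by (rule carrierE)
  then have s using h(2) elem_in_rotations_iff[of 1 k s] by simp
  then show ?thesis using that h(1) k by simp
qed

text \<open>The rotations times one reflection of \<open>H\<close> give all reflections; the
  rotations times the identity give all rotations.\<close>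

lemma rotations_1_set_mult:
  assumes "subgroup H G" "\<not> H \<subseteq> rotations 1"
  shows "rotations 1 <#> H = carrier G"
proof
  show "rotations 1 <#> H \<subseteq> carrier G"
    using assms(1) subgroup_rotations by (auto simp: set_mult_def dest: subgroup.mem_carrier)
  obtain k where k: "elem k True \<in> H" using assms by (rule reflection_exponent)
  show "carrier G \<subseteq> rotations 1 <#> H"
  proof
    fix x assume "x \<in> carrier G"
    then obtain i s where x: "x = elem i s" by (rule carrierE)
    show "x \<in> rotations 1 <#> H"
    proof (cases s)
      case True
      have "elem (i - k) False \<otimes> elem k True \<in> rotations 1 <#> H"
        using k by (intro set_multI) (simp_all add: elem_in_rotations_iff)
      then show ?thesis using True by (simp add: x elem_mult)
    next
      case False
      have "elem i False \<otimes> \<one> \<in> rotations 1 <#> H"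
        using subgroup.one_closed[OF assms(1)] by (intro set_multI) (simp_all add: elem_in_rotations_iff)
      then show ?thesis using False by (simp add: x)
    qed
  qed
qed

text \<open>A product of rotations is a rotation, so the product set misses the reflection
  \<open>elem 0 True\<close>.\<close>

lemma not_comaximal_if_rotations:
  assumes "H \<subseteq> rotations 1" "K \<subseteq> rotations 1"
  shows "H <#> K \<noteq> carrier G"
proof
  assume "H <#> K = carrier G"
  then have "elem 0 True \<in> H <#> K" by simp
  then obtain h k where "h \<in> H" "k \<in> K" "elem 0 True = h \<otimes> k" by (rule set_multE)
  moreover from this obtain i j where "h = elem i False" "k = elem j False"
    using assms by (meson rotationsE subsetD)
  ultimately have "elem 0 True = elem i False \<otimes> elem j False" by simp
  then show False by (simp add: elem_mult elem_eq_iff)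
qed

text \<open>The exponents of the rotations in \<open>H\<close> form an ideal of the integers
  containing \<open>n\<close>. Bezout identities can therefore be read as membership in
  \<open>H\<close>.\<close>

lemma rotation_exponents:
  assumes "subgroup H G"
  shows "elem i False \<in> H \<Longrightarrow> elem j False \<in> H \<Longrightarrow> elem (i + j) False \<in> H"
    and "elem i False \<in> H \<Longrightarrow> elem (i * k) False \<in> H"
    and "elem (int n * k) False \<in> H"
proof -
  interpret H: subgroup H G by fact
  show add: "elem (i + j) False \<in> H" if "elem i False \<in> H" "elem j False \<in> H" for i j
    using H.m_closed[OF that] by (simp add: elem_mult)
  have zero: "elem 0 False \<in> H" using H.one_closed by (simp add: one_eq)
  have nat: "elem (i * int m) False \<in> H" if "elem i False \<in> H" for i m
  proof (induction m)
    case (Suc m)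
    then show ?case using add[OF that Suc] by (simp add: algebra_simps)
  qed (simp add: zero)
  show "elem (i * k) False \<in> H" if "elem i False \<in> H" for i k
  proof (cases "k \<ge> 0")
    case True
    then show ?thesis using nat[OF that, of "nat k"] by simp
  next
    case False
    then have "elem (- (i * k)) False \<in> H" using nat[OF that, of "nat (- k)"] by simp
    from H.m_inv_closed[OF this] show ?thesis by (simp add: inv_elem)
  qed
  have "elem (int n * k) False = elem 0 False" by (simp add: elem_eq_iff)
  then show "elem (int n * k) False \<in> H" using zero by simp
qed

lemma rotations_1_subset:
  assumes "subgroup H G" "elem 1 False \<in> H"
  shows "rotations 1 \<subseteq> H"
  using rotation_exponents(2)[OF assms] by (auto elim!: rotationsE)

lemma subgroup_eq_carrier:
  assumes "subgroup H G" "elem 1 False \<in> H" "\<not> H \<subseteq> rotations 1"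
  shows "H = carrier G"
proof -
  have "carrier G = rotations 1 <#> H" using rotations_1_set_mult[OF assms(1,3)] by simp
  also have "\<dots> \<subseteq> H"
    using rotations_1_subset[OF assms(1,2)] subgroup.m_closed[OF assms(1)]
    by (auto simp: set_mult_def)
  finally show ?thesis using subgroup.subset[OF assms(1)] by blast
qed

section \<open>Non-trivial proper subgroups and the prime power case\<close>

lemma rotations_proper:
  assumes "d dvd int n" "\<not> int n dvd d"
  shows "rotations d \<in> nontrivial_proper_subgroups G"
proof -
  have "elem d False \<in> rotations d" "elem d False \<noteq> \<one>"
    using assms by (auto simp: elem_in_rotations_iff one_eq elem_eq_iff)
  moreover have "elem 0 True \<notin> rotations d" by (simp add: elem_in_rotations_iff[OF assms(1)])
  ultimately show ?thesis
    using subgroup_rotations by (auto simp: nontrivial_proper_subgroups_def)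
qed

lemma dihedral_subgroup_proper:
  assumes "d dvd int n" "\<not> d dvd 1"
  shows "dihedral_subgroup d j \<in> nontrivial_proper_subgroups G"
proof -
  have "elem j True \<in> dihedral_subgroup d j" "elem j True \<noteq> \<one>"
    using assms by (auto simp: elem_in_dihedral_subgroup_iff one_eq elem_eq_iff)
  moreover have "elem 1 False \<notin> dihedral_subgroup d j"
    using assms by (simp add: elem_in_dihedral_subgroup_iff)
  ultimately show ?thesis
    using subgroup_dihedral_subgroup[OF assms(1)] by (auto simp: nontrivial_proper_subgroups_def)
qed

lemma dihedral_subgroup_not_rotations:
  assumes "d dvd int n"
  shows "\<not> dihedral_subgroup d j \<subseteq> rotations 1"
proof -
  have "elem j True \<in> dihedral_subgroup d j" by (simp add: elem_in_dihedral_subgroup_iff[OF assms])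
  moreover have "elem j True \<notin> rotations 1" by (simp add: elem_in_rotations_iff)
  ultimately show ?thesis by blast
qed

lemma rotations_1_vertex: "rotations 1 \<in> comaximal_vertices G"
proof -
  \<comment> \<open>As \<open>a^n\<close> is the identity, the partner chosen here is the
    two-element subgroup generated by \<open>b\<close>.\<close>
  have "rotations 1 <#> dihedral_subgroup (int n) 0 = carrier G"
    by (intro rotations_1_set_mult subgroup_dihedral_subgroup dihedral_subgroup_not_rotations) simp_all
  moreover have "rotations 1 \<in> nontrivial_proper_subgroups G"
    using n_ge_2 by (intro rotations_proper) auto
  moreover have "dihedral_subgroup (int n) 0 \<in> nontrivial_proper_subgroups G"
    using n_ge_2 by (intro dihedral_subgroup_proper) auto
  ultimately show ?thesis
    unfolding comaximal_vertices_def by blast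
qed

text \<open>Let a vertex \<open>H\<close> of rotations have the partner \<open>K\<close>, and factor
  \<open>a\<close> as \<open>a^i\<close> in \<open>H\<close> times \<open>a^(1 - i)\<close> in
  \<open>K\<close>. Since \<open>p\<close> cannot divide both exponents, one of the factors
  generates all rotations, so \<open>H\<close> is the full rotation subgroup or \<open>K\<close> the
  whole group.\<close>

lemma prime_power_imp_star:
  assumes "prime p" "n = p ^ \<alpha>"
  shows "star_hypergraph (comaximal_hypergraph G)"
proof (rule comaximal_star)
  fix H assume H: "H \<in> comaximal_vertices G" "H \<noteq> rotations 1"
  then have sub: "subgroup H G"
    by (simp add: comaximal_vertices_def nontrivial_proper_subgroups_def)
  have "\<not> H \<subseteq> rotations 1"
  proof
    assume rot: "H \<subseteq> rotations 1"
    obtain K where K: "subgroup K G" "K \<noteq> carrier G" "H <#> K = carrier G"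
      using H(1) by (auto simp: comaximal_vertices_def nontrivial_proper_subgroups_def)
    have K_rot: "\<not> K \<subseteq> rotations 1" using not_comaximal_if_rotations[OF rot] K(3) by blast
    have "elem 1 False \<in> H <#> K" using K(3) by simp
    then obtain h y where h: "h \<in> H" "y \<in> K" "elem 1 False = h \<otimes> y" by (rule set_multE)
    then obtain i where "h = elem i False" using rot by (meson rotationsE subsetD)
    then have i: "elem i False \<in> H" "y \<in> K" "elem 1 False = elem i False \<otimes> y" using h by simp_all
    obtain l t where y: "y = elem l t" using subgroup.mem_carrier[OF K(1) i(2)] by (rule carrierE)
    then have "\<not> t" "int n dvd 1 - (i + l)" using i(3) by (auto simp: elem_mult elem_eq_iff)
    then have "y = elem (1 - i) False" by (simp add: y elem_eq_iff dvd_diff_commute algebra_simps)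
    then have K_i: "elem (1 - i) False \<in> K" using i(2) by simp
    \<comment> \<open>An exponent prime to \<open>p\<close> is invertible modulo the power
      \<open>n\<close> of \<open>p\<close>.\<close>
    have generate: "elem 1 False \<in> L" if "subgroup L G" "elem k False \<in> L" "\<not> int p dvd k" for L k
    proof -
      have "coprime (int p) k" using that(3) assms(1) by (simp add: prime_imp_coprime)
      then have "coprime k (int n)" by (simp add: assms(2) coprime_commute)
      then obtain u v where "k * u + int n * v = 1"
        by (metis bezout_int coprime_imp_gcd_eq_1 mult.commute)
      then show ?thesis using rotation_exponents[OF that(1)] that(2) by metis
    qed
    have "\<not> int p dvd i \<or> \<not> int p dvd 1 - i"
    proof (rule ccontr)
      assume "\<not> ?thesis"
      then have "int p dvd i + (1 - i)" by (intro dvd_add) auto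
      then show False using assms(1) by (simp add: not_prime_unit)
    qed
    then show False
    proof
      assume "\<not> int p dvd i"
      then have "rotations 1 \<subseteq> H" using generate[OF sub i(1)] rotations_1_subset[OF sub] by blast
      then show False using rot H(2) by blast
    next
      assume "\<not> int p dvd 1 - i"
      then show False using generate[OF K(1) K_i] subgroup_eq_carrier[OF K(1) _ K_rot] K(2) by blast
    qed
  qed
  then show "rotations 1 <#> H = carrier G" by (rule rotations_1_set_mult[OF sub])
qed (use rotations_1_vertex group_axioms in auto)

section \<open>Odd prime factors and the cycle in a host tree\<close>

lemma rotations_set_mult_dihedral:
  assumes "coprime d e" "e dvd int n"
  shows "rotations d <#> dihedral_subgroup e j = carrier G"
proof
  show "rotations d <#> dihedral_subgroup e j \<subseteq> carrier G"
    by (auto elim!: set_multE rotationsE dihedral_subgroupE)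
  obtain u v where uv: "u * d + v * e = 1"
    using assms(1) by (metis bezout_int coprime_imp_gcd_eq_1)
  show "carrier G \<subseteq> rotations d <#> dihedral_subgroup e j"
  proof
    fix x assume "x \<in> carrier G"
    then obtain i s where x: "x = elem i s" by (rule carrierE)
    \<comment> \<open>Bezout splits \<open>k\<close> into a multiple of \<open>d\<close>, used for
      the rotation, and a multiple of \<open>e\<close>. The offset \<open>l\<close> puts the
      exponent of a reflection back into the class of \<open>j\<close>.\<close>
    define k where "k = (if s then i - j else i)"
    define l where "l = (if s then j else 0)"
    have "i = k * (u * d + v * e) + l" by (simp add: uv k_def l_def)
    then have "x = elem (k * u * d) False \<otimes> elem (k * v * e + l) s"
      by (simp add: x elem_mult algebra_simps)
    moreover have "elem (k * u * d) False \<in> rotations d" by (simp add: rotationsI)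
    moreover have "elem (k * v * e + l) s \<in> dihedral_subgroup e j"
      by (simp add: elem_in_dihedral_subgroup_iff[OF assms(2)] l_def)
    ultimately show "x \<in> rotations d <#> dihedral_subgroup e j" by (simp only: set_multI)
  qed
qed

text \<open>This makes the pair of \<open>rotations (int d)\<close> and
  \<open>dihedral_subgroup (int q) j\<close> maximal. Comaximality with the first forces all
  rotation exponents in \<open>X\<close> to be multiples of \<open>q\<close>; then its product with
  the second has rotation exponents in at most two classes modulo \<open>q\<close>, while
  \<open>q\<close> is at least 3.\<close>

lemma not_comaximal_rotations_and_dihedral:
  assumes n: "n = q ^ \<beta> * d" and q: "prime q" "q \<noteq> 2" "\<beta> > 0"
    and X: "X \<in> nontrivial_proper_subgroups G" and Rd: "X <#> rotations (int d) = carrier G"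
  shows "X <#> dihedral_subgroup (int q) j \<noteq> carrier G"
proof
  assume Q: "X <#> dihedral_subgroup (int q) j = carrier G"
  have sub: "subgroup X G" and "X \<noteq> carrier G"
    using X by (auto simp: nontrivial_proper_subgroups_def)
  have X_rot: "\<not> X \<subseteq> rotations 1"
    using not_comaximal_if_rotations[OF _ rotations_subset_1] Rd by blast
  have "elem 1 False \<in> X <#> rotations (int d)" using Rd by simp
  then obtain x y where y: "x \<in> X" "y \<in> rotations (int d)" "elem 1 False = x \<otimes> y"
    by (rule set_multE)
  obtain i where "y = elem i False" "int d dvd i" using y(2) by (rule rotationsE)
  then obtain m where "y = elem (int d * m) False" by auto
  then have x: "x \<in> X" "elem 1 False = x \<otimes> elem (int d * m) False" using y by simp_all
  obtain i\<^sub>0 s\<^sub>0 where x_elem: "x = elem i\<^sub>0 s\<^sub>0" using subgroup.mem_carrier[OF sub x(1)] by (rule carrierE)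
  have "\<not> s\<^sub>0" "int n dvd 1 - (i\<^sub>0 + int d * m)"
    using x(2) by (auto simp: x_elem elem_mult elem_eq_iff)
  then have "elem (1 - int d * m) False = x" by (simp add: x_elem elem_eq_iff algebra_simps)
  then have X_d: "elem (1 - int d * m) False \<in> X" using x(1) by simp
  have q_dvd: "int q dvd i" if i: "elem i False \<in> X" for i
  proof (rule ccontr)
    assume "\<not> int q dvd i"
    then have "coprime (int q) i" using q(1) by (simp add: prime_imp_coprime)
    then have "coprime i (int q ^ \<beta>)" by (simp add: coprime_commute)
    then obtain u v where "i * u + int q ^ \<beta> * v = 1"
      by (metis bezout_int coprime_imp_gcd_eq_1 mult.commute)
    \<comment> \<open>Multiplied by \<open>d * m\<close>, the Bezout identity has the modulus
      \<open>n\<close> in its second term. So \<open>a^(d * m)\<close> lies in \<open>X\<close>, and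
      together with \<open>X_d\<close> so does \<open>a\<close>.\<close>
    then have "int d * m = int d * m * (i * u + int q ^ \<beta> * v)" by simp
    also have "\<dots> = i * (u * int d * m) + int n * (v * m)" by (simp add: n algebra_simps)
    finally have "elem (int d * m) False \<in> X" using rotation_exponents[OF sub] i by metis
    then have "elem (1 - int d * m + int d * m) False \<in> X"
      by (rule rotation_exponents(1)[OF sub X_d])
    then have "elem 1 False \<in> X" by simp
    then show False using subgroup_eq_carrier[OF sub _ X_rot] \<open>X \<noteq> carrier G\<close> by blast
  qed
  obtain k where k: "elem k True \<in> X" using sub X_rot by (rule reflection_exponent)
  have refl: "int q dvd i - k" if "elem i True \<in> X" for i
    using q_dvd[of "i - k"] subgroup.m_closed[OF sub that k] by (simp add: elem_mult)
  have "q > 2" using q(1,2) prime_ge_2_nat[of q] by linarith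
  have "\<not> int q dvd 1" "\<not> int q dvd 2" using \<open>q > 2\<close> by (auto dest: zdvd_imp_le)
  have q_n: "int q dvd int n" using q(3) by (simp add: n)
  \<comment> \<open>modulo \<open>q\<close>, a rotation in the product has exponent \<open>0\<close> or \<open>k - j\<close>\<close>
  have exps: "int q dvd i \<or> int q dvd i - (k - j)" for i
  proof -
    have "elem i False \<in> X <#> dihedral_subgroup (int q) j" using Q by simp
    then obtain y z where yz: "y \<in> X" "z \<in> dihedral_subgroup (int q) j" "elem i False = y \<otimes> z"
      by (rule set_multE)
    then obtain l t where "z = elem l t" "int q dvd (if t then l - j else l)"
      by (meson dihedral_subgroupE)
    then have y: "y \<in> X" "elem i False = y \<otimes> elem l t" "int q dvd (if t then l - j else l)"
      using yz by simp_all
    obtain r s where "y = elem r s" using subgroup.mem_carrier[OF sub y(1)] by (rule carrierE)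
    \<comment> \<open>The product is a rotation, so its factors are both rotations or both
      reflections.\<close>
    then have "t = s" and "int n dvd i - (if s then r - l else r + l)"
      using y(2) by (auto simp: elem_mult elem_eq_iff)
    then have i: "int q dvd i - (if s then r - l else r + l)" using q_n by auto
    show ?thesis
    proof (cases s)
      case True
      then have "int q dvd r - k" "int q dvd l - j" "int q dvd i - (r - l)"
        using refl y \<open>y = elem r s\<close> \<open>t = s\<close> i by auto
      then have "int q dvd i - (r - l) + (r - k - (l - j))" using dvd_add dvd_diff by blast
      then show ?thesis by (simp add: algebra_simps)
    next
      case False
      then have "int q dvd r" "int q dvd l" "int q dvd i - (r + l)"
        using q_dvd y \<open>y = elem r s\<close> \<open>t = s\<close> i by auto
      then have "int q dvd i - (r + l) + (r + l)" using dvd_add by blast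
      then show ?thesis by simp
    qed
  qed
  \<comment> \<open>Neither 1 nor 2 is in the class of 0, so both would be in the class of
    \<open>k - j\<close>; but they differ by 1.\<close>
  have "int q dvd 2 - (k - j)" "int q dvd 1 - (k - j)"
    using exps[of 1] exps[of 2] \<open>\<not> int q dvd 1\<close> \<open>\<not> int q dvd 2\<close> by auto
  then have "int q dvd (2 - (k - j)) - (1 - (k - j))" by (rule dvd_diff)
  then show False using \<open>\<not> int q dvd 1\<close> by simp
qed

lemma not_hypertree_if_odd_prime_factor:
  assumes n: "n = q ^ \<beta> * d" and q: "prime q" "q \<noteq> 2" "\<not> q dvd d" "\<beta> > 0" and d: "d > 1"
  shows "\<not> hypertree (comaximal_hypergraph G)"
proof
  let ?R = "rotations (int d)" and ?Q = "dihedral_subgroup (int q)"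
  let ?V = "comaximal_vertices G" and ?H = "comaximal_hypergraph G"
  assume "hypertree ?H"
  then obtain E where tree: "tree_graph ?V E"
    and conn: "\<And>D. D \<in> snd ?H \<Longrightarrow> connected_graph D (induced_edges E D)"
    by (auto simp: hypertree_def comaximal_hypergraph_def)
  have q_n: "int q dvd int n" and d_n: "int d dvd int n" using q(4) by (auto simp: n)
  \<comment> \<open>Hence \<open>d < n\<close>, and \<open>a^d\<close> is not the identity.\<close>
  have "q ^ \<beta> > 1" using prime_gt_1_nat[OF q(1)] q(4) by (rule one_less_power)
  then have "\<not> n dvd d" using d q(4) by (auto simp: n dest!: dvd_imp_le)
  then have R: "?R \<in> nontrivial_proper_subgroups G" using rotations_proper[OF d_n] by simp
  have "\<not> int q dvd 1" using q(1) by auto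
  then have Q: "?Q j \<in> nontrivial_proper_subgroups G" for j
    using dihedral_subgroup_proper[OF q_n] by blast
  have sub: "subgroup ?R G" "subgroup (?Q j) G" for j
    using subgroup_rotations subgroup_dihedral_subgroup[OF q_n] by auto
  have "coprime q d" using q(1,3) by (rule prime_imp_coprime)
  then have "coprime (int d) (int q)" by (simp add: coprime_commute)
  then have RQ: "?R <#> ?Q j = carrier G" for j by (rule rotations_set_mult_dihedral[OF _ q_n])
  then have QR: "?Q j <#> ?R = carrier G" for j by (rule set_mult_eq_carrier_commute[OF sub])
  have V: "?R \<in> ?V" "?Q j \<in> ?V" for j
    using R Q RQ QR unfolding comaximal_vertices_def by blast+
  have neq: "?Q j \<noteq> ?R" for j
    using dihedral_subgroup_not_rotations[OF q_n] rotations_subset_1 by metis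
  have edge: "{?R, ?Q j} \<in> E" for j
  proof (rule connected_induced_pair)
    \<comment> \<open>No third vertex fits, so the pair is itself a hyperedge.\<close>
    have "X \<in> {?R, ?Q j}"
      if E': "E' \<subseteq> ?V" "pairwise_comaximal G E'" "{?R, ?Q j} \<subseteq> E'" "X \<in> E'" for E' X
    proof (rule ccontr)
      assume X: "X \<notin> {?R, ?Q j}"
      then have "X <#> ?R = carrier G" "X <#> ?Q j = carrier G"
        using E' by (auto simp: pairwise_comaximal_def)
      moreover have "X \<in> nontrivial_proper_subgroups G"
        using E' by (auto simp: comaximal_vertices_def)
      ultimately show False using not_comaximal_rotations_and_dihedral[OF n q(1,2,4)] by blast
    qed
    then have "{?R, ?Q j} \<in> snd ?H"
      using V pairwise_comaximal_pairI[OF group_axioms sub RQ]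
      unfolding comaximal_hypergraph_def snd_conv by blast
    then show "connected_graph {?R, ?Q j} (induced_edges E {?R, ?Q j})" by (rule conn)
    show "?R \<noteq> ?Q j" using neq[of j] by simp
    show "simple_graph ?V E" using tree by (simp add: tree_graph_def)
  qed
  let ?C = "rotations 1"
  have "elem 1 False \<in> ?C" "elem 1 False \<notin> ?R"
    using d by (simp_all add: elem_in_rotations_iff[OF d_n] elem_in_rotations_iff)
  then have "?C \<noteq> ?R" by blast
  have avoid: "(?Q j, ?C) \<in> {(u, v). {u, v} \<in> E \<and> v \<noteq> ?R}\<^sup>*"
    "(?C, ?Q j) \<in> {(u, v). {u, v} \<in> E \<and> v \<noteq> ?R}\<^sup>*" for j
  proof -
    have "?C <#> ?Q j = carrier G"
      using rotations_1_set_mult[OF sub(2) dihedral_subgroup_not_rotations[OF q_n]] .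
    then have "pairwise_comaximal G {?C, ?Q j}"
      by (rule pairwise_comaximal_pairI[OF group_axioms subgroup_rotations sub(2)])
    moreover have "{?C, ?Q j} \<subseteq> ?V" using rotations_1_vertex V(2) by simp
    ultimately obtain D where D: "D \<in> snd ?H" "{?C, ?Q j} \<subseteq> D"
      using comaximal_hyperedge_extension[OF finite_carrier] by blast
    \<comment> \<open>Both \<open>?C\<close> and \<open>?R\<close> consist of rotations, so no
      hyperedge contains both.\<close>
    have "?R \<notin> D"
    proof
      assume "?R \<in> D"
      then have "?C <#> ?R = carrier G"
        using D \<open>?C \<noteq> ?R\<close> by (auto simp: comaximal_hypergraph_def pairwise_comaximal_def)
      then show False using not_comaximal_if_rotations[OF _ rotations_subset_1] by blast
    qed
    then show "(?Q j, ?C) \<in> {(u, v). {u, v} \<in> E \<and> v \<noteq> ?R}\<^sup>*"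
      "(?C, ?Q j) \<in> {(u, v). {u, v} \<in> E \<and> v \<noteq> ?R}\<^sup>*"
      using connected_induced_avoiding[OF conn[OF D(1)]] D(2) by auto
  qed
  \<comment> \<open>The reflection \<open>a b\<close> separates the two neighbours of
    \<open>?R\<close>.\<close>
  have "elem 1 True \<in> ?Q 1" "elem 1 True \<notin> ?Q 0"
    using \<open>\<not> int q dvd 1\<close> by (simp_all add: elem_in_dihedral_subgroup_iff[OF q_n])
  then have "?Q 0 \<noteq> ?Q 1" by blast
  moreover have "(?Q 0, ?Q 1) \<in> {(u, v). {u, v} \<in> E \<and> v \<noteq> ?R}\<^sup>*"
    using avoid by (rule rtrancl_trans)
  ultimately have "\<exists>c. graph_cycle E c"
    by (rule graph_cycle_through[OF edge edge _ neq[symmetric]])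
  then show False using tree by (simp add: tree_graph_def)
qed

end

section \<open>The presented dihedral group\<close>

text \<open>The action on \<open>(0, False)\<close> solves the word problem: each word is congruent
  to a normal form with exponent below \<open>n\<close>, and that normal form can be recovered from
  its action.\<close>

lemma word_cong_dihedral_iff:
  assumes "n \<ge> 1"
  shows "word_cong (dihedral_relations n) u v \<longleftrightarrow>
    dihedral_equiv n (foldr dihedral_act u (0, False)) (foldr dihedral_act v (0, False))"
proof
  assume equiv: "dihedral_equiv n (foldr dihedral_act u (0, False)) (foldr dihedral_act v (0, False))"
  have nf: "foldr dihedral_act (dihedral_nf (i, s)) (0, False) = (int i, s)" for i s
    by (simp add: dihedral_nf_def funpow_dihedral_act)
  obtain i s j t where *: "i < n" "word_cong (dihedral_relations n) u (dihedral_nf (i, s))"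
      "j < n" "word_cong (dihedral_relations n) v (dihedral_nf (j, t))"
    using word_class_dihedral_nf[OF assms] by meson
  have "dihedral_equiv n (int i, s) (foldr dihedral_act u (0, False))"
    "dihedral_equiv n (foldr dihedral_act v (0, False)) (int j, t)"
    using word_cong_dihedral_act[OF word_cong.sym[OF *(2)], of "(0, False)"]
      word_cong_dihedral_act[OF *(4), of "(0, False)"] by (simp_all add: nf)
  then have "dihedral_equiv n (int i, s) (int j, t)" using equiv dihedral_equiv_trans by blast
  then have "int i mod int n = int j mod int n" "s = t"
    by (auto simp: dihedral_equiv_def mod_eq_dvd_iff)
  then have "i = j" "s = t" using * by auto
  then show "word_cong (dihedral_relations n) u v"
    using * by (blast intro: word_cong.trans word_cong.sym)
qed (rule word_cong_dihedral_act)

text \<open>Normal forms take natural exponents, so an integer exponent is first reduced modulo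
  \<open>n\<close>; the locale axioms then become congruences through the word problem.\<close>

lemma dihedral_dihedral_group:
  assumes "n \<ge> 2"
  shows "dihedral (dihedral_group n) n
    (\<lambda>i s. word_class (dihedral_relations n) (dihedral_nf (nat (i mod int n), s)))"
proof -
  let ?w = "\<lambda>i s. dihedral_nf (nat (i mod int n), s)"
  have n: "n \<ge> 1" using assms by simp
  have act: "foldr dihedral_act (?w i s) (j, t) = (if s then i mod int n - j else i mod int n + j, s \<noteq> t)"
    for i s j t using n by (simp add: dihedral_nf_def funpow_dihedral_act)
  interpret group "dihedral_group n" by (rule group_dihedral_group)
  show ?thesis
  proof
    show "n \<ge> 2" by fact
    show "carrier (dihedral_group n) = range (\<lambda>(i, s). word_class (dihedral_relations n) (?w i s))"
    proof
      show "carrier (dihedral_group n) \<subseteq> range (\<lambda>(i, s). word_class (dihedral_relations n) (?w i s))"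
      proof
        fix X assume "X \<in> carrier (dihedral_group n)"
        then obtain u where u: "X = word_class (dihedral_relations n) u"
          by (auto simp: dihedral_group_def presented_group_def)
        obtain i s where "i < n" "word_cong (dihedral_relations n) u (dihedral_nf (i, s))"
          using word_class_dihedral_nf[OF n] by blast
        then have "X = word_class (dihedral_relations n) (?w (int i) s)"
          by (simp add: u word_class_eq_iff)
        then show "X \<in> range (\<lambda>(i, s). word_class (dihedral_relations n) (?w i s))" by auto
      qed
    qed (auto simp: dihedral_group_def presented_group_def)
  next
    fix i s j t
    have "int n dvd (if s then i mod int n - j mod int n else i mod int n + j mod int n) -
        (if s then i - j else i + j) mod int n"
      by (auto simp: mod_eq_dvd_iff[symmetric] mod_simps)
    then show "word_class (dihedral_relations n) (?w i s) \<otimes>\<^bsub>dihedral_group n\<^esub>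
        word_class (dihedral_relations n) (?w j t) =
      word_class (dihedral_relations n) (?w (if s then i - j else i + j) (s \<noteq> t))"
      by (cases s; cases t) (simp_all add: dihedral_group_def mult_presented_group word_class_eq_iff
          word_cong_dihedral_iff[OF n] act dihedral_equiv_def)
  next
    fix i s j t
    show "word_class (dihedral_relations n) (?w i s) = word_class (dihedral_relations n) (?w j t) \<longleftrightarrow>
      int n dvd i - j \<and> s = t"
      by (simp add: word_class_eq_iff word_cong_dihedral_iff[OF n] act dihedral_equiv_def)
        (simp add: mod_eq_dvd_iff[symmetric])
  qed
qed

text \<open>If the prime factor found first is 2, the cofactor left after removing all factors 2
  exceeds 1, as \<open>n\<close> is no power of 2, and its prime factors are odd.\<close>

lemma odd_prime_factor_if_not_prime_power:
  fixes n :: nat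
  assumes "n \<ge> 2" "\<nexists>p \<alpha> :: nat. prime p \<and> \<alpha> \<ge> 1 \<and> n = p ^ \<alpha>"
  obtains q \<beta> d where "prime q" "q \<noteq> 2" "n = q ^ \<beta> * d" "\<not> q dvd d" "\<beta> > 0" "d > 1"
proof -
  have split: "\<exists>\<beta> d. n = p ^ \<beta> * d \<and> \<not> p dvd d \<and> \<beta> > 0 \<and> d > 1" if p: "prime p" "p dvd n" for p
  proof -
    have "n \<noteq> 0" "\<not> is_unit p" using assms(1) p(1) not_prime_unit by auto
    then obtain d where d: "n = p ^ multiplicity p n * d" "\<not> p dvd d"
      by (rule multiplicity_decompose')
    have \<beta>: "multiplicity p n \<ge> 1"
      using p assms(1) by (simp add: prime_multiplicity_gt_zero_iff Suc_le_eq)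
    have "d \<noteq> 0" using d assms(1) by (metis mult_0_right not_numeral_le_zero)
    moreover have "d \<noteq> 1" using d(1) assms(2) p(1) \<beta> by auto
    ultimately show ?thesis using d \<beta> by (metis One_nat_def Suc_le_eq less_one linorder_neqE_nat)
  qed
  obtain p where p: "prime p" "p dvd n" using prime_factor_nat[of n] assms(1) by auto
  have "\<exists>q. prime q \<and> q dvd n \<and> q \<noteq> 2"
  proof (cases "p = 2")
    case True
    obtain \<beta> d where d: "n = p ^ \<beta> * d" "\<not> p dvd d" "d > 1" using split[OF p] by blast
    then obtain q where "prime q" "q dvd d" using prime_factor_nat[of d] by auto
    then show ?thesis using d True by auto
  qed (use p in blast)
  then show ?thesis using split that by blast
qed

theorem theorem2p5:
  fixes n :: nat
  assumes "n \<ge> 2"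
  shows "(hypertree (comaximal_hypergraph (dihedral_group n)) \<longleftrightarrow>
            (\<exists>p \<alpha> :: nat. prime p \<and> \<alpha> \<ge> 1 \<and> n = p ^ \<alpha>)) \<and>
         ((\<exists>p \<alpha> :: nat. prime p \<and> \<alpha> \<ge> 1 \<and> n = p ^ \<alpha>) \<longleftrightarrow>
            star_hypergraph (comaximal_hypergraph (dihedral_group n)))"
proof -
  interpret dihedral "dihedral_group n" n
    "\<lambda>i s. word_class (dihedral_relations n) (dihedral_nf (nat (i mod int n), s))"
    using assms by (rule dihedral_dihedral_group)
  let ?H = "comaximal_hypergraph (dihedral_group n)"
  let ?P = "\<exists>p \<alpha> :: nat. prime p \<and> \<alpha> \<ge> 1 \<and> n = p ^ \<alpha>"
  \<comment> \<open>The implications run in a circle: hypertree, prime power, star,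
    hypertree.\<close>
  have "?P" if "hypertree ?H"
    using odd_prime_factor_if_not_prime_power[OF assms] not_hypertree_if_odd_prime_factor that
    by metis
  moreover have "star_hypergraph ?H" if "?P" using that prime_power_imp_star by blast
  moreover have "hypertree ?H" if "star_hypergraph ?H"
    using that by (rule star_hypergraph_imp_hypertree) (auto simp: comaximal_hypergraph_def)
  ultimately show ?thesis by blast
qed

end
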